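(* Let $Q$ be a connected finite acyclic quiver with vertices $1,\dots,n$ labelled as in the context, let $h(\mathbf{x})$ be an invariant Laurent polynomial for $Q$ of period $k$, and let $a_\ast\in\mathbb{C}^n$ be a generic specialization of $\mathbf{x}$. For each $t\ge 0$ let $c_t=h(\mu_\ast^t(a_\ast))\in\mathbb{C}$ and write $h(\mu_\ast^t(\mathbf{x}))=f_t(\mathbf{x})/g_t(\mathbf{x})$ in lowest terms with $f_t,g_t\in\mathbb{C}[\mathbf{x}]$. For $0\le j<k$ and $0\le t<k$ let $$F_{j,t}(\mathbf{x}):=f_t(\mathbf{x})-c_{t+j}\,g_t(\mathbf{x})$$ be the numerator of the rational function $h(\mu_\ast^t(\mathbf{x}))-h(\mu_\ast^{j+t}(a_\ast))$, and for $0\le j<k$ let $X_j\subset\mathbb{C}^n$ be the intersection of the $k$ zero sets $\{F_{j,t}(\mathbf{x})=0\}$, $0\le t<k$. Then the generalized frieze variety $X(Q,a_\ast)$ is contained in the union $X_0\cup X_1\cup\cdots\cup X_{k-1}$.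
   Context: $Q$ is a connected finite quiver without oriented cycles (multiple arrows allowed), with vertices labelled $1,\dots,n$ so that if there is an arrow $i\to j$ then $i>j$. Coxeter mutation: for $a_\ast=(a_1,\dots,a_n)\in(\mathbb{C}^\times)^n$ put $\mu_\ast(a_\ast)=(a_1',\dots,a_n')\in\mathbb{C}^n$, where recursively for $k=1,\dots,n$ $$a_k'=\frac{1+\prod_{j\to k}a_j\prod_{k\to j}a_j'}{a_k},$$ the products running over all arrows of $Q$ ending at $k$, respectively starting at $k$, counted with multiplicity. The same formulas applied to a tuple of indeterminates $\mathbf{x}=(x_1,\dots,x_n)$ define $\mu_\ast(\mathbf{x})\in\mathbb{C}(\mathbf{x})^n$. (This is the cluster obtained from the initial cluster $\mathbf{x}$ of the cluster algebra of $Q$ by the mutation sequence $\mu_n\circ\cdots\circ\mu_2\circ\mu_1$.) $\mu_\ast^t$ denotes the $t$-fold iterate; by the Laurent phenomenon the coordinates of $\mu_\ast^t(\mathbf{x})$ are Laurent polynomials in $\mathbf{x}$. A point $a_\ast\in\mathbb{C}^n$ is a generic specialization of $\mathbf{x}$ if all coordinates of $\mu_\ast^t(a_\ast)$ are nonzero for all $t\ge 0$. The $\mu_\ast$-orbit of $a_\ast$ is $\{\mu_\ast^t(a_\ast):t\ge 0\}$, and the generalized frieze variety $X(Q,a_\ast)$ is the Zariski closure in $\mathbb{C}^n$ of the $\mu_\ast$-orbit of $a_\ast$. A rational function $h(\mathbf{x})\in\mathbb{C}(\mathbf{x})$ is invariant under $\mu_\ast^k$ if $h(\mu_\ast^k(\mathbf{x}))=h(\mathbf{x})$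 in $\mathbb{C}(\mathbf{x})$. If $h$ is a Laurent polynomial in $x_1,\dots,x_n$ and $k>0$ is the minimal positive integer for which this holds, $h$ is called an invariant Laurent polynomial for $Q$ of period $k$. *)

theory Defs
  imports
    "Graph_Theory.Digraph_Component"
    "HOL-Library.Poly_Mapping"
    "HOL-Computational_Algebra.Fraction_Field"
begin

section \<open>Polynomials and rational functions in several variables\<close>

text \<open>
  The variables are indexed by a finite linearly ordered type \<open>'v\<close>, which plays the role of
  \<open>{1, \<dots>, n}\<close>; points of \<open>\<complex>\<^sup>n\<close> are functions \<open>'v \<Rightarrow> complex\<close>. A polynomial is a finitely supported
  map from exponent vectors to coefficients. The linear order on \<open>'v\<close> also gives the library's
  proof that these polynomials form an integral domain.
\<close>

type_synonym 'v mpoly = "('v \<Rightarrow>\<^sub>0 nat) \<Rightarrow>\<^sub>0 complex"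

type_synonym 'v ratfun = "(('v \<Rightarrow>\<^sub>0 nat) \<Rightarrow>\<^sub>0 complex) fract"

definition Const :: "complex \<Rightarrow> 'v mpoly" where
  "Const c = Poly_Mapping.single 0 c"

definition Var :: "'v \<Rightarrow> 'v mpoly" where
  "Var i = Poly_Mapping.single (Poly_Mapping.single i 1) 1"

text \<open>
  Evaluation of a polynomial at a tuple \<open>a\<close> of elements of a \<open>\<complex>\<close>-algebra with structure map \<open>\<phi>\<close>.
  Only \<open>\<complex>\<close> itself and \<open>\<complex>(x)\<close> are used below.
\<close>

definition mpoly_eval ::
    "(complex \<Rightarrow> 'f) \<Rightarrow> ('v \<Rightarrow> 'f) \<Rightarrow> 'v::finite mpoly \<Rightarrow> 'f::comm_ring_1" where
  "mpoly_eval \<phi> a p =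
     (\<Sum>m\<in>Poly_Mapping.keys p. \<phi> (Poly_Mapping.lookup p m) * (\<Prod>i\<in>UNIV. a i ^ Poly_Mapping.lookup m i))"

text \<open>
  The value of a rational function at \<open>a\<close>, computed from any representation whose denominator does
  not vanish at \<open>a\<close>. The value does not depend on the representation (lemma \<open>ratfun_eval_Fract\<close>);
  it is unspecified if there is no such representation.
\<close>

definition ratfun_eval ::
    "(complex \<Rightarrow> 'f) \<Rightarrow> ('v \<Rightarrow> 'f) \<Rightarrow> 'v::{finite,linorder} ratfun \<Rightarrow> 'f::field" where
  "ratfun_eval \<phi> a h =
     (THE y. \<exists>p q. h = Fract p q \<and> mpoly_eval \<phi> a q \<noteq> 0 \<and>
                   y = mpoly_eval \<phi> a p / mpoly_eval \<phi> a q)"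

context
  fixes \<phi> :: "complex \<Rightarrow> 'f::field"
  assumes hom_zero: "\<phi> 0 = 0"
    and hom_add: "\<And>x y. \<phi> (x + y) = \<phi> x + \<phi> y"
    and hom_mult: "\<And>x y. \<phi> (x * y) = \<phi> x * \<phi> y"
begin

lemma mpoly_eval_single:
  "mpoly_eval \<phi> a (Poly_Mapping.single m c) = \<phi> c * (\<Prod>i\<in>UNIV. a i ^ Poly_Mapping.lookup m i)"
  by (auto simp: mpoly_eval_def hom_zero)

lemma mpoly_eval_zero: "mpoly_eval \<phi> a 0 = 0"
  by (simp add: mpoly_eval_def)

lemma mpoly_eval_superset:
  assumes "finite S" "Poly_Mapping.keys p \<subseteq> S"
  shows "mpoly_eval \<phi> a p =
    (\<Sum>m\<in>S. \<phi> (Poly_Mapping.lookup p m) * (\<Prod>i\<in>UNIV. a i ^ Poly_Mapping.lookup m i))"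
  unfolding mpoly_eval_def
  by (rule sum.mono_neutral_left) (use assms in \<open>auto simp: in_keys_iff hom_zero\<close>)

lemma mpoly_eval_add: "mpoly_eval \<phi> a (p + q) = mpoly_eval \<phi> a p + mpoly_eval \<phi> a q"
proof -
  let ?S = "Poly_Mapping.keys p \<union> Poly_Mapping.keys q"
  have "Poly_Mapping.keys (p + q) \<subseteq> ?S"
    by (rule Poly_Mapping.keys_add)
  then show ?thesis
    by (simp add: mpoly_eval_superset[of ?S] lookup_add hom_add distrib_right sum.distrib)
qed

lemma mpoly_eval_sum: "mpoly_eval \<phi> a (\<Sum>x\<in>A. p x) = (\<Sum>x\<in>A. mpoly_eval \<phi> a (p x))"
  by (induction A rule: infinite_finite_induct) (auto simp: mpoly_eval_zero mpoly_eval_add)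

lemma mpoly_sum_monomials:
  "(\<Sum>m\<in>Poly_Mapping.keys p. Poly_Mapping.single m (Poly_Mapping.lookup p m)) = p"
  by (rule poly_mapping_eqI)
     (simp add: lookup_sum lookup_single when_def in_keys_iff)

lemma mpoly_eval_mult: "mpoly_eval \<phi> a (p * q) = mpoly_eval \<phi> a p * mpoly_eval \<phi> a q"
proof -
  let ?s = "\<lambda>p m. Poly_Mapping.single m (Poly_Mapping.lookup p m)"
  have single: "mpoly_eval \<phi> a (?s p m * ?s q m') = mpoly_eval \<phi> a (?s p m) * mpoly_eval \<phi> a (?s q m')"
    for m m'
    by (simp add: mult_single mpoly_eval_single hom_mult lookup_add power_add prod.distrib)
  have "p * q = (\<Sum>m\<in>Poly_Mapping.keys p. ?s p m) * (\<Sum>m\<in>Poly_Mapping.keys q. ?s q m)"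
    by (simp add: mpoly_sum_monomials)
  then have "mpoly_eval \<phi> a (p * q) =
      mpoly_eval \<phi> a (\<Sum>m\<in>Poly_Mapping.keys p. ?s p m) * mpoly_eval \<phi> a (\<Sum>m\<in>Poly_Mapping.keys q. ?s q m)"
    by (simp only: sum_product mpoly_eval_sum single)
  then show ?thesis
    by (simp add: mpoly_sum_monomials)
qed

lemma ratfun_eval_Fract:
  assumes "mpoly_eval \<phi> a q \<noteq> 0"
  shows "ratfun_eval \<phi> a (Fract p q) = mpoly_eval \<phi> a p / mpoly_eval \<phi> a q"
  unfolding ratfun_eval_def
proof (rule the_equality)
  show "\<exists>p' q'. Fract p q = Fract p' q' \<and> mpoly_eval \<phi> a q' \<noteq> 0 \<and>
      mpoly_eval \<phi> a p / mpoly_eval \<phi> a q = mpoly_eval \<phi> a p' / mpoly_eval \<phi> a q'"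
    using assms by blast
next
  fix y
  assume "\<exists>p' q'. Fract p q = Fract p' q' \<and> mpoly_eval \<phi> a q' \<noteq> 0 \<and>
      y = mpoly_eval \<phi> a p' / mpoly_eval \<phi> a q'"
  then obtain p' q' where eq: "Fract p q = Fract p' q'" and nz: "mpoly_eval \<phi> a q' \<noteq> 0"
    and y: "y = mpoly_eval \<phi> a p' / mpoly_eval \<phi> a q'"
    by blast
  have "q \<noteq> 0" "q' \<noteq> 0"
    using assms nz by (auto simp: mpoly_eval_zero)
  with eq have "p * q' = p' * q"
    by (simp add: eq_fract)
  then have "mpoly_eval \<phi> a p * mpoly_eval \<phi> a q' = mpoly_eval \<phi> a p' * mpoly_eval \<phi> a q"
    by (simp flip: mpoly_eval_mult)
  then show "y = mpoly_eval \<phi> a p / mpoly_eval \<phi> a q"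
    using assms nz by (simp add: y frac_eq_eq)
qed

end

abbreviation mpoly_at :: "'v::finite mpoly \<Rightarrow> ('v \<Rightarrow> complex) \<Rightarrow> complex" where
  "mpoly_at p a \<equiv> mpoly_eval (\<lambda>c. c) a p"

abbreviation ratfun_at :: "'v::{finite,linorder} ratfun \<Rightarrow> ('v \<Rightarrow> complex) \<Rightarrow> complex" where
  "ratfun_at h a \<equiv> ratfun_eval (\<lambda>c. c) a h"

abbreviation ratfun_subst ::
    "'v::{finite,linorder} ratfun \<Rightarrow> ('v \<Rightarrow> 'v ratfun) \<Rightarrow> 'v ratfun" where
  "ratfun_subst h r \<equiv> ratfun_eval (\<lambda>c. Fract (Const c) 1) r h"

definition indets :: "'v::linorder \<Rightarrow> 'v ratfun" where
  "indets i = Fract (Var i) 1"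

definition is_laurent_polynomial :: "'v::linorder ratfun \<Rightarrow> bool" where
  "is_laurent_polynomial h \<longleftrightarrow> (\<exists>p e. h = Fract p (Poly_Mapping.single e 1))"

text \<open>Polynomials are not an instance of the class for which the library defines \<^const>\<open>coprime\<close>.\<close>

definition lowest_terms :: "'a::idom fract \<Rightarrow> 'a \<Rightarrow> 'a \<Rightarrow> bool" where
  "lowest_terms r p q \<longleftrightarrow>
     q \<noteq> 0 \<and> r = Fract p q \<and> (\<forall>d. d dvd p \<longrightarrow> d dvd q \<longrightarrow> d dvd 1)"


section \<open>Zariski topology on affine space\<close>

definition zero_set :: "'v::finite mpoly set \<Rightarrow> ('v \<Rightarrow> complex) set" where
  "zero_set P = {a. \<forall>p\<in>P. mpoly_at p a = 0}"

definition zariski_closed :: "('v::finite \<Rightarrow> complex) set \<Rightarrow> bool" where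
  "zariski_closed Z \<longleftrightarrow> (\<exists>P. Z = zero_set P)"

definition zariski_closure :: "('v::finite \<Rightarrow> complex) set \<Rightarrow> ('v \<Rightarrow> complex) set" where
  "zariski_closure S = zariski_closed hull S"


section \<open>Coxeter mutation and frieze varieties\<close>

text \<open>
  An arrow \<open>e\<close> goes from \<open>tail Q e\<close> to \<open>head Q e\<close>. Acyclicity follows from
  \<open>arrow_descending\<close>; it is listed because it is part of the standing assumptions.
\<close>

locale labelled_acyclic_quiver = fin_digraph Q
  for Q :: "('v::{finite,linorder}, 'e) pre_digraph" (structure) +
  assumes verts_UNIV: "verts Q = UNIV"
    and connected_quiver: "Digraph_Component.connected Q"
    and no_oriented_cycle: "\<not> (\<exists>p. cycle p)"
    and arrow_descending: "e \<in> arcs Q \<Longrightarrow> tail Q e > head Q e"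
begin

text \<open>The products range over the set of arrows, hence count multiplicities.\<close>

function coxeter_mutation :: "('v \<Rightarrow> 'f::field) \<Rightarrow> 'v \<Rightarrow> 'f" where
  "coxeter_mutation a k =
     (1 + (\<Prod>e\<in>{e \<in> arcs Q. head Q e = k}. a (tail Q e)) *
          (\<Prod>e\<in>{e \<in> arcs Q. tail Q e = k}. coxeter_mutation a (head Q e))) / a k"
  by pat_completeness auto
termination
proof (relation "inv_image {(i, j). i < j} snd")
  have "trans {(i, j). i < (j::'v)}"
    by (auto simp: trans_def)
  then have "acyclic {(i, j). i < (j::'v)}"
    by (simp add: acyclic_def)
  then show "wf (inv_image {(i, j). i < (j::'v)} snd)"
    by (intro wf_inv_image finite_acyclic_wf) auto
qed (use arrow_descending in auto)

declare coxeter_mutation.simps [simp del]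

text \<open>
  Division by zero is total here, but under this condition no division by zero occurs at any
  stage of the iteration.
\<close>

definition generic_specialization :: "('v \<Rightarrow> complex) \<Rightarrow> bool" where
  "generic_specialization a \<longleftrightarrow> (\<forall>t i. (coxeter_mutation ^^ t) a i \<noteq> 0)"

definition orbit :: "('v \<Rightarrow> complex) \<Rightarrow> ('v \<Rightarrow> complex) set" where
  "orbit a = {(coxeter_mutation ^^ t) a | t. True}"

definition frieze_variety :: "('v \<Rightarrow> complex) \<Rightarrow> ('v \<Rightarrow> complex) set" where
  "frieze_variety a = zariski_closure (orbit a)"

definition invariant_under :: "'v ratfun \<Rightarrow> nat \<Rightarrow> bool" where
  "invariant_under h k \<longleftrightarrow> ratfun_subst h ((coxeter_mutation ^^ k) indets) = h"

definition invariant_laurent_polynomial :: "'v ratfun \<Rightarrow> nat \<Rightarrow> bool" where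
  "invariant_laurent_polynomial h k \<longleftrightarrow>
     is_laurent_polynomial h \<and> 0 < k \<and> invariant_under h k \<and>
     (\<forall>k'. 0 < k' \<and> k' < k \<longrightarrow> \<not> invariant_under h k')"

end

end

theory Submission
  imports Defs
begin

text \<open>
  Every formula in sight may be evaluated at a point of the orbit. A rational function that is
  regular at a point \<open>b\<close> specializes to a complex number there, and specialization is a ring
  homomorphism compatible with substitution. Coxeter mutation divides only by the coordinates of
  the tuple to which it is applied, so if no coordinate of an iterate of \<open>b\<close> vanishes, the rational
  functions \<open>\<mu>\<^sup>t(x)\<close> are regular at \<open>b\<close> and specialize to \<open>\<mu>\<^sup>t(b)\<close>
  (\<open>specializes_coxeter_mutation_iterate\<close>). A Laurent polynomial \<open>h\<close> is regular wherever no
  coordinate vanishes, so \<open>h(\<mu>\<^sup>t(x))\<close> specializes at \<open>b\<close> to the number \<open>h(\<mu>\<^sup>t(b))\<close>.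

  Two consequences finish the proof. Specializing \<open>h(\<mu>\<^sup>k(x)) = h(x)\<close> at the points of the orbit
  shows that the sequence \<open>c\<close> has period \<open>k\<close>. Specializing \<open>h(\<mu>\<^sup>t(x)) = f\<^sub>t / g\<^sub>t\<close> at
  \<open>b = \<mu>\<^sup>s(a)\<close> gives \<open>f\<^sub>t(b) = c\<^bsub>t+s\<^esub> g\<^sub>t(b)\<close>, and by periodicity the constant may be
  replaced by \<open>c\<^bsub>t+j\<^esub>\<close> with \<open>j = s mod k\<close>. Hence \<open>\<mu>\<^sup>s(a)\<close> lies in \<open>X\<^sub>j\<close>. So the orbit is
  contained in the union of the \<open>X\<^sub>j\<close>, which is Zariski closed because it is a finite union of
  zero sets, and therefore contains the closure of the orbit.
\<close>

section \<open>Evaluation of polynomials and rational functions\<close>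

lemma mpoly_at_add: "mpoly_at (p + q) a = mpoly_at p a + mpoly_at q a"
  by (rule mpoly_eval_add) auto

lemma mpoly_at_mult: "mpoly_at (p * q) a = mpoly_at p a * mpoly_at q a"
  by (rule mpoly_eval_mult) auto

lemma mpoly_at_zero: "mpoly_at 0 a = 0"
  by (rule mpoly_eval_zero) auto

lemma mpoly_at_single:
  "mpoly_at (Poly_Mapping.single m c) a = c * (\<Prod>i\<in>UNIV. a i ^ Poly_Mapping.lookup m i)"
  by (rule mpoly_eval_single) auto

lemma mpoly_at_Const: "mpoly_at (Const c) a = c"
  by (simp add: Const_def mpoly_at_single)

lemma mpoly_at_one: "mpoly_at 1 a = 1"
  using mpoly_at_Const[where c = 1] by (simp add: Const_def)

lemma mpoly_at_Var: "mpoly_at (Var i) a = a i"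
proof -
  have "(\<Prod>l\<in>UNIV. a l ^ Poly_Mapping.lookup (Poly_Mapping.single i 1) l) =
      (\<Prod>l\<in>UNIV. if i = l then a l else 1)"
    by (rule prod.cong) (auto simp: lookup_single when_def)
  then show ?thesis
    by (simp add: Var_def mpoly_at_single)
qed

lemma mpoly_at_diff: "mpoly_at (p - q) a = mpoly_at p a - mpoly_at q a"
  using mpoly_at_add[where p = "p - q" and q = q] by simp

lemma Fract_Const_zero: "Fract (Const 0) 1 = (0 :: 'v::linorder ratfun)"
  by (simp add: Const_def Zero_fract_def)

lemma Fract_Const_add:
  "Fract (Const (x + y)) 1 = (Fract (Const x) 1 + Fract (Const y) 1 :: 'v::linorder ratfun)"
  by (simp add: Const_def single_add)

lemma Fract_Const_mult:
  "Fract (Const (x * y)) 1 = (Fract (Const x) 1 * Fract (Const y) 1 :: 'v::linorder ratfun)"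
  by (simp add: Const_def mult_single)

lemmas Fract_Const_hom = Fract_Const_zero Fract_Const_add Fract_Const_mult

text \<open>
  The relation records regularity at \<open>a\<close> together with the value, which
  \<^const>\<open>ratfun_eval\<close> alone does not express.
\<close>

definition specializes_to ::
    "('v::{finite,linorder} \<Rightarrow> complex) \<Rightarrow> 'v ratfun \<Rightarrow> complex \<Rightarrow> bool" where
  "specializes_to a r y \<longleftrightarrow>
     (\<exists>p q. r = Fract p q \<and> mpoly_at q a \<noteq> 0 \<and> y = mpoly_at p a / mpoly_at q a)"

text \<open>
  Cross-multiplication makes sense for every representation of the rational function, even one
  whose denominator vanishes at \<open>a\<close>.
\<close>

lemma specializes_to_Fract_imp:
  assumes "specializes_to a (Fract p q) y" "q \<noteq> 0"
  shows "mpoly_at p a = y * mpoly_at q a"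
proof -
  obtain p' q' where eq: "Fract p q = Fract p' q'" and nz: "mpoly_at q' a \<noteq> 0"
    and y: "y = mpoly_at p' a / mpoly_at q' a"
    using assms(1) by (auto simp: specializes_to_def)
  have "q' \<noteq> 0"
    using nz by (auto simp: mpoly_at_zero)
  with eq assms(2) have "p * q' = p' * q"
    by (simp add: eq_fract)
  then have "mpoly_at p a * mpoly_at q' a = mpoly_at p' a * mpoly_at q a"
    by (simp flip: mpoly_at_mult)
  then show ?thesis
    using nz by (simp add: y field_simps)
qed

lemma specializes_to_ratfun_at:
  assumes "specializes_to a r y"
  shows "ratfun_at r a = y"
  using assms by (auto simp: specializes_to_def intro: ratfun_eval_Fract)

lemma specializes_to_Fract:
  "mpoly_at q a \<noteq> 0 \<Longrightarrow> specializes_to a (Fract p q) (mpoly_at p a / mpoly_at q a)"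
  by (auto simp: specializes_to_def)

lemma specializes_to_polynomial: "specializes_to a (Fract p 1) (mpoly_at p a)"
  using specializes_to_Fract[where q = 1 and p = p] by (simp add: mpoly_at_one)

lemma specializes_to_Const: "specializes_to a (Fract (Const c) 1) c"
  using specializes_to_polynomial[where p = "Const c"] by (simp add: mpoly_at_Const)

lemma specializes_to_indets: "specializes_to a (indets i) (a i)"
  using specializes_to_polynomial[where p = "Var i"] by (simp add: indets_def mpoly_at_Var)

lemma specializes_to_zero: "specializes_to a 0 0"
  using specializes_to_Const[where c = 0] by (simp add: Fract_Const_zero)

lemma specializes_to_one: "specializes_to a 1 1"
  using specializes_to_polynomial[where p = 1] by (simp add: mpoly_at_one One_fract_def)

lemma specializes_to_add:
  assumes "specializes_to a r x" "specializes_to a s y"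
  shows "specializes_to a (r + s) (x + y)"
proof -
  obtain p q where r: "r = Fract p q" "mpoly_at q a \<noteq> 0" "x = mpoly_at p a / mpoly_at q a"
    using assms(1) by (auto simp: specializes_to_def)
  obtain p' q' where s: "s = Fract p' q'" "mpoly_at q' a \<noteq> 0" "y = mpoly_at p' a / mpoly_at q' a"
    using assms(2) by (auto simp: specializes_to_def)
  have "q \<noteq> 0" "q' \<noteq> 0"
    using r s by (auto simp: mpoly_at_zero)
  then have "r + s = Fract (p * q' + p' * q) (q * q')"
    by (simp add: r s)
  then show ?thesis
    using specializes_to_Fract[where q = "q * q'" and p = "p * q' + p' * q"] r s
    by (simp add: mpoly_at_add mpoly_at_mult add_frac_eq)
qed

lemma specializes_to_mult:
  assumes "specializes_to a r x" "specializes_to a s y"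
  shows "specializes_to a (r * s) (x * y)"
proof -
  obtain p q where r: "r = Fract p q" "mpoly_at q a \<noteq> 0" "x = mpoly_at p a / mpoly_at q a"
    using assms(1) by (auto simp: specializes_to_def)
  obtain p' q' where s: "s = Fract p' q'" "mpoly_at q' a \<noteq> 0" "y = mpoly_at p' a / mpoly_at q' a"
    using assms(2) by (auto simp: specializes_to_def)
  show ?thesis
    using specializes_to_Fract[where q = "q * q'" and p = "p * p'"] r s
    by (simp add: mpoly_at_mult)
qed

lemma specializes_to_inverse:
  assumes "specializes_to a r x" "x \<noteq> 0"
  shows "specializes_to a (inverse r) (inverse x)"
proof -
  obtain p q where r: "r = Fract p q" "mpoly_at q a \<noteq> 0" "x = mpoly_at p a / mpoly_at q a"
    using assms(1) by (auto simp: specializes_to_def)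
  then show ?thesis
    using specializes_to_Fract[where q = p and p = q] assms(2) by simp
qed

lemma specializes_to_divide:
  assumes "specializes_to a r x" "specializes_to a s y" "y \<noteq> 0"
  shows "specializes_to a (r / s) (x / y)"
  unfolding divide_inverse by (intro specializes_to_mult specializes_to_inverse assms)

lemma specializes_to_nonzero:
  assumes "specializes_to a r x" "x \<noteq> 0"
  shows "r \<noteq> 0"
  using specializes_to_ratfun_at[OF assms(1)] specializes_to_ratfun_at[OF specializes_to_zero] assms(2)
  by auto

lemma specializes_to_sum:
  assumes "\<And>i. i \<in> A \<Longrightarrow> specializes_to a (r i) (x i)"
  shows "specializes_to a (\<Sum>i\<in>A. r i) (\<Sum>i\<in>A. x i)"
  using assms
  by (induction A rule: infinite_finite_induct) (auto intro: specializes_to_zero specializes_to_add)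

lemma specializes_to_prod:
  assumes "\<And>i. i \<in> A \<Longrightarrow> specializes_to a (r i) (x i)"
  shows "specializes_to a (\<Prod>i\<in>A. r i) (\<Prod>i\<in>A. x i)"
  using assms
  by (induction A rule: infinite_finite_induct) (auto intro: specializes_to_one specializes_to_mult)

lemma specializes_to_power:
  assumes "specializes_to a r x"
  shows "specializes_to a (r ^ m) (x ^ m)"
  by (induction m) (auto intro: specializes_to_one specializes_to_mult assms)

lemma specializes_to_mpoly_eval:
  assumes "\<And>i. specializes_to a (r i) (b i)"
  shows "specializes_to a (mpoly_eval (\<lambda>c. Fract (Const c) 1) r p) (mpoly_at p b)"
  unfolding mpoly_eval_def
  by (intro specializes_to_sum specializes_to_mult specializes_to_Const specializes_to_prod
      specializes_to_power assms)

text \<open>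
  Specialization commutes with composition of rational maps. Regularity of \<open>h\<close> at \<open>b\<close> also
  ensures that substituting \<open>r\<close> does not annihilate the denominator of \<open>h\<close>: an element that
  specializes to a nonzero number is nonzero.
\<close>

lemma specializes_to_ratfun_subst:
  assumes r: "\<And>i. specializes_to a (r i) (b i)" and h: "specializes_to b h y"
  shows "specializes_to a (ratfun_subst h r) y"
proof -
  let ?ev = "mpoly_eval (\<lambda>c. Fract (Const c) 1) r"
  obtain p q where h: "h = Fract p q" "mpoly_at q b \<noteq> 0" "y = mpoly_at p b / mpoly_at q b"
    using h by (auto simp: specializes_to_def)
  have sp: "specializes_to a (?ev u) (mpoly_at u b)" for u
    by (rule specializes_to_mpoly_eval[OF r])
  then have "?ev q \<noteq> 0"
    using h(2) by (rule specializes_to_nonzero)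
  then have "ratfun_subst h r = ?ev p / ?ev q"
    unfolding h(1) by (intro ratfun_eval_Fract Fract_Const_hom)
  then show ?thesis
    using specializes_to_divide[OF sp sp h(2)] h(3) by simp
qed

lemma laurent_polynomial_specializes:
  assumes "is_laurent_polynomial h" "\<And>i. b i \<noteq> 0"
  shows "specializes_to b h (ratfun_at h b)"
proof -
  obtain p e where h: "h = Fract p (Poly_Mapping.single e 1)"
    using assms(1) by (auto simp: is_laurent_polynomial_def)
  have "mpoly_at (Poly_Mapping.single e 1) b \<noteq> 0"
    by (simp add: mpoly_at_single assms(2))
  then have "\<exists>y. specializes_to b h y"
    unfolding h by (blast intro: specializes_to_Fract)
  then show ?thesis
    using specializes_to_ratfun_at by auto
qed


section \<open>Zariski closed sets\<close>

lemma zariski_closed_zero_set: "zariski_closed (zero_set P)"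
  by (auto simp: zariski_closed_def)

lemma zariski_closed_Un:
  assumes "zariski_closed Y" "zariski_closed Z"
  shows "zariski_closed (Y \<union> Z)"
proof -
  obtain P R where "Y = zero_set P" "Z = zero_set R"
    using assms by (auto simp: zariski_closed_def)
  then have "Y \<union> Z = zero_set {p * r | p r. p \<in> P \<and> r \<in> R}"
    by (fastforce simp: zero_set_def mpoly_at_mult)
  then show ?thesis
    by (simp add: zariski_closed_zero_set)
qed

lemma zariski_closed_empty: "zariski_closed {}"
  unfolding zariski_closed_def
  by (rule exI[of _ "{1}"]) (simp add: zero_set_def mpoly_at_one)

lemma zariski_closed_UN:
  assumes "finite J" "\<And>j. j \<in> J \<Longrightarrow> zariski_closed (X j)"
  shows "zariski_closed (\<Union>j\<in>J. X j)"
  using assms by (induction J) (auto intro: zariski_closed_empty zariski_closed_Un)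

lemma zariski_closed_INT_zero_set: "zariski_closed (\<Inter>t\<in>T. zero_set (P t))"
proof -
  have "(\<Inter>t\<in>T. zero_set (P t)) = zero_set (\<Union>t\<in>T. P t)"
    by (auto simp: zero_set_def)
  then show ?thesis
    by (simp add: zariski_closed_zero_set)
qed


section \<open>Specialization of Coxeter mutation\<close>

context labelled_acyclic_quiver
begin

text \<open>
  The recursion in \<^const>\<open>coxeter_mutation\<close> reuses coordinates already mutated, but only as
  factors of the numerator; so only the coordinates of \<open>b\<close> itself have to be invertible.
\<close>

lemma specializes_coxeter_mutation:
  assumes "\<And>i. specializes_to a (r i) (b i)" "\<And>i. b i \<noteq> 0"
  shows "specializes_to a (coxeter_mutation r l) (coxeter_mutation b l)"
  using assms(1)
proof (induction r l rule: coxeter_mutation.induct)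
  case (1 r l)
  have "specializes_to a (coxeter_mutation r (head Q e)) (coxeter_mutation b (head Q e))"
    if "e \<in> {e \<in> arcs Q. tail Q e = l}" for e
    using that 1 by blast
  then show ?case
    unfolding coxeter_mutation.simps[of _ l]
    by (intro specializes_to_divide specializes_to_add specializes_to_one specializes_to_mult
        specializes_to_prod 1 assms(2))
qed

lemma specializes_coxeter_mutation_iterate:
  assumes "generic_specialization b"
  shows "specializes_to b ((coxeter_mutation ^^ t) indets i) ((coxeter_mutation ^^ t) b i)"
proof (induction t arbitrary: i)
  case 0
  then show ?case
    by (simp add: specializes_to_indets)
next
  case (Suc t)
  then show ?case
    using assms by (auto simp: generic_specialization_def intro: specializes_coxeter_mutation)
qed

lemma generic_specialization_iterate:
  assumes "generic_specialization a"
  shows "generic_specialization ((coxeter_mutation ^^ s) a)"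
  unfolding generic_specialization_def
proof (intro allI)
  fix t i
  show "(coxeter_mutation ^^ t) ((coxeter_mutation ^^ s) a) i \<noteq> 0"
    using assms[unfolded generic_specialization_def, rule_format, of "t + s" i]
    by (simp add: funpow_add)
qed

lemma laurent_polynomial_specializes_iterate:
  assumes "is_laurent_polynomial h" "generic_specialization b"
  shows "specializes_to b (ratfun_subst h ((coxeter_mutation ^^ t) indets))
    (ratfun_at h ((coxeter_mutation ^^ t) b))"
proof (rule specializes_to_ratfun_subst)
  show "specializes_to ((coxeter_mutation ^^ t) b) h (ratfun_at h ((coxeter_mutation ^^ t) b))"
    using assms by (intro laurent_polynomial_specializes) (auto simp: generic_specialization_def)
qed (rule specializes_coxeter_mutation_iterate[OF assms(2)])

lemma invariant_under_ratfun_at: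
  assumes "is_laurent_polynomial h" "invariant_under h k" "generic_specialization b"
  shows "ratfun_at h ((coxeter_mutation ^^ k) b) = ratfun_at h b"
  using specializes_to_ratfun_at[OF laurent_polynomial_specializes_iterate[OF assms(1,3), of k]]
    assms(2)
  by (simp add: invariant_under_def)

lemma ratfun_at_iterate_mod:
  assumes "is_laurent_polynomial h" "invariant_under h k" "generic_specialization a"
  shows "ratfun_at h ((coxeter_mutation ^^ (t + s)) a) =
    ratfun_at h ((coxeter_mutation ^^ (t + s mod k)) a)"
proof -
  have "ratfun_at h ((coxeter_mutation ^^ (m + q * k)) a) =
      ratfun_at h ((coxeter_mutation ^^ m) a)" for m q
  proof (induction q)
    case (Suc q)
    have "(coxeter_mutation ^^ (m + Suc q * k)) a =
        (coxeter_mutation ^^ k) ((coxeter_mutation ^^ (m + q * k)) a)"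
      by (simp add: funpow_add[symmetric, THEN fun_cong, unfolded o_apply] ac_simps)
    then show ?case
      using Suc invariant_under_ratfun_at[OF assms(1,2) generic_specialization_iterate[OF assms(3)]]
      by simp
  qed simp
  from this[of "t + s mod k" "s div k"] show ?thesis
    by (simp add: add.assoc)
qed

end


section \<open>Invariant Laurent polynomials and the frieze variety\<close>

theorem proposition4p2:
  fixes Q :: "('v::{finite,linorder}, 'e) pre_digraph"
    and h :: "'v ratfun"
    and k :: nat
    and a :: "'v \<Rightarrow> complex"
    and c :: "nat \<Rightarrow> complex"
    and f g :: "nat \<Rightarrow> 'v mpoly"
    and F :: "nat \<Rightarrow> nat \<Rightarrow> 'v mpoly"
    and X :: "nat \<Rightarrow> ('v \<Rightarrow> complex) set"
  assumes quiver: "labelled_acyclic_quiver Q"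
    and invariant: "labelled_acyclic_quiver.invariant_laurent_polynomial Q h k"
    and generic: "labelled_acyclic_quiver.generic_specialization Q a"
    and c_def: "\<And>t. c t = ratfun_at h ((labelled_acyclic_quiver.coxeter_mutation Q ^^ t) a)"
    and lowest: "\<And>t. lowest_terms
          (ratfun_subst h ((labelled_acyclic_quiver.coxeter_mutation Q ^^ t) indets)) (f t) (g t)"
    and F_def: "\<And>j t. \<lbrakk>j < k; t < k\<rbrakk> \<Longrightarrow> F j t = f t - Const (c (t + j)) * g t"
    and X_def: "\<And>j. j < k \<Longrightarrow> X j = (\<Inter>t\<in>{..<k}. zero_set {F j t})"
  shows "labelled_acyclic_quiver.frieze_variety Q a \<subseteq> (\<Union>j\<in>{..<k}. X j)"
proof -
  interpret labelled_acyclic_quiver Q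
    by (rule quiver)
  have laurent: "is_laurent_polynomial h" and k: "0 < k" and inv: "invariant_under h k"
    using invariant by (auto simp: invariant_laurent_polynomial_def)
  have "orbit a \<subseteq> (\<Union>j\<in>{..<k}. X j)"
  proof
    fix b
    assume "b \<in> orbit a"
    then obtain s where b: "b = (coxeter_mutation ^^ s) a"
      by (auto simp: orbit_def)
    have gen_b: "generic_specialization b"
      unfolding b using generic by (rule generic_specialization_iterate)
    have j: "s mod k < k"
      using k by simp
    have "mpoly_at (F (s mod k) t) b = 0" if t: "t < k" for t
    proof -
      have g: "g t \<noteq> 0" "ratfun_subst h ((coxeter_mutation ^^ t) indets) = Fract (f t) (g t)"
        using lowest[of t] by (auto simp: lowest_terms_def)
      have "ratfun_at h ((coxeter_mutation ^^ t) b) = c (t + s)"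
        by (simp add: c_def b funpow_add)
      also have "\<dots> = c (t + s mod k)"
        unfolding c_def by (rule ratfun_at_iterate_mod[OF laurent inv generic])
      finally have "specializes_to b (Fract (f t) (g t)) (c (t + s mod k))"
        using laurent_polynomial_specializes_iterate[OF laurent gen_b, of t] g(2) by simp
      then have "mpoly_at (f t) b = c (t + s mod k) * mpoly_at (g t) b"
        using g(1) by (rule specializes_to_Fract_imp)
      then show ?thesis
        by (simp add: F_def[OF j t] mpoly_at_diff mpoly_at_mult mpoly_at_Const)
    qed
    then have "b \<in> X (s mod k)"
      by (simp add: X_def[OF j] zero_set_def)
    then show "b \<in> (\<Union>j\<in>{..<k}. X j)"
      using j by blast
  qed
  moreover have "zariski_closed (\<Union>j\<in>{..<k}. X j)"
    by (rule zariski_closed_UN) (simp_all add: X_def zariski_closed_INT_zero_set)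
  ultimately show ?thesis
    unfolding frieze_variety_def zariski_closure_def by (rule hull_minimal)
qed

end
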